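(* For every positive integer $k$, $\operatorname{inv}(\triangle^{k-1}(TT_2)) \geq \frac{k}{2}-1$.
   Context: All graphs are finite. An oriented graph is a digraph without loops and with at most one arc between any two vertices. For an oriented graph $D$ and a set $X\subseteq V(D)$, the inversion of $X$ in $D$ consists in reversing the direction of all arcs of $D$ with both end-vertices in $X$. For a finite family $(X_i)_{i\in I}$ of subsets of $V(D)$, $\operatorname{Inv}(D;(X_i)_{i\in I})$ is the oriented graph obtained by inverting the $X_i$ one after another (the order is irrelevant: an arc is reversed if and only if an odd number of the $X_i$ contain both its end-vertices). The family is a decycling family of $D$ if the resulting oriented graph is acyclic (has no directed cycle). The inversion number $\operatorname{inv}(D)$ is the minimum cardinality of a decycling family of $D$. For an oriented graph $D$, $\triangle(D)$ is the oriented graph obtained from $D$ by adding two new vertices $u,v$, all the arcs from $V(D)$ to $u$, the arc $uv$, and all the arcs from $v$ to $V(D)$. $\triangle^{j}$ denotes the $j$-fold iteration of this operation, with $\triangle^0(D)=D$. $TT_2$ is the transitive tournament on two vertices (two vertices joined by a single arc). *)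

theory Defs
  imports Complex_Main "Graph_Theory.Graph_Theory"
begin

locale oriented_graph = pair_digraph +
  assumes arcs_asym: "(x, y) \<in> parcs G \<Longrightarrow> (y, x) \<notin> parcs G"

definition invert :: "'a set \<Rightarrow> 'a pair_pre_digraph \<Rightarrow> 'a pair_pre_digraph" where
  "invert X D = D\<lparr>parcs := (\<lambda>(x, y). if x \<in> X \<and> y \<in> X then (y, x) else (x, y)) ` parcs D\<rparr>"

text \<open>Finite families of vertex sets are lists, so that repetitions count towards the cardinality.\<close>

definition Inv :: "'a pair_pre_digraph \<Rightarrow> 'a set list \<Rightarrow> 'a pair_pre_digraph" where
  "Inv D Xs = fold invert Xs D"

definition acyclic_digraph :: "'a pair_pre_digraph \<Rightarrow> bool" where
  "acyclic_digraph D \<longleftrightarrow> \<not> (\<exists>p. pre_digraph.cycle (with_proj D) p)"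

definition decycling_family :: "'a pair_pre_digraph \<Rightarrow> 'a set list \<Rightarrow> bool" where
  "decycling_family D Xs \<longleftrightarrow> (\<forall>X \<in> set Xs. X \<subseteq> pverts D) \<and> acyclic_digraph (Inv D Xs)"

text \<open>
  Every oriented graph has a decycling family (reverse arcs one at a time by inverting
  their end-vertices), so this infimum of natural numbers is a minimum.
\<close>

definition inversion_number :: "'a pair_pre_digraph \<Rightarrow> nat" where
  "inversion_number D = Inf {length Xs | Xs. decycling_family D Xs}"

text \<open>
  The names of the two new vertices are irrelevant, so \<open>\<triangle>\<close> is rendered as a relation
  between \<open>D\<close> and all realisations of \<open>\<triangle>(D)\<close> on the same vertex type; its \<open>j\<close>-fold iteration
  is the relation power.
\<close>

definition is_triangle :: "'a pair_pre_digraph \<Rightarrow> 'a pair_pre_digraph \<Rightarrow> bool" where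
  "is_triangle D E \<longleftrightarrow> (\<exists>u v. u \<notin> pverts D \<and> v \<notin> pverts D \<and> u \<noteq> v \<and>
     E = \<lparr>pverts = pverts D \<union> {u, v},
          parcs = parcs D \<union> pverts D \<times> {u} \<union> {(u, v)} \<union> {v} \<times> pverts D\<rparr>)"

definition is_TT2 :: "'a pair_pre_digraph \<Rightarrow> bool" where
  "is_TT2 D \<longleftrightarrow> (\<exists>a b. a \<noteq> b \<and> D = \<lparr>pverts = {a, b}, parcs = {(a, b)}\<rparr>)"

lemma is_TT2_oriented:
  assumes "is_TT2 D" shows "oriented_graph D"
  using assms unfolding is_TT2_def by (elim exE conjE) (unfold_locales, auto)

lemma is_triangle_oriented:
  assumes "oriented_graph D" "is_triangle D E" shows "oriented_graph E"
proof -
  interpret oriented_graph D by fact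
  obtain u v where *: "u \<notin> pverts D" "v \<notin> pverts D" "u \<noteq> v"
    "E = \<lparr>pverts = pverts D \<union> {u, v},
          parcs = parcs D \<union> pverts D \<times> {u} \<union> {(u, v)} \<union> {v} \<times> pverts D\<rparr>"
    using assms(2) unfolding is_triangle_def by blast
  have arc: "x \<in> pverts D \<and> y \<in> pverts D \<and> x \<noteq> y \<and> (y, x) \<notin> parcs D" if "(x, y) \<in> parcs D" for x y
    using that arcs_asym[OF that] in_arcsD1[OF that] in_arcsD2[OF that] no_loops[of "(x, y)"]
    by auto
  show ?thesis
    using arc * by unfold_locales (auto dest: arc)
qed

lemma iterated_triangle_exists:
  assumes "infinite (UNIV :: 'a set)"
  shows "\<exists>T D :: 'a pair_pre_digraph. is_TT2 T \<and> (is_triangle ^^ j) T D \<and> oriented_graph D"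
proof (induction j)
  case 0
  obtain a b :: 'a where "a \<noteq> b"
    using assms by (metis ex_new_if_finite finite.emptyI finite.insertI insertI1)
  then have "is_TT2 \<lparr>pverts = {a, b}, parcs = {(a, b)}\<rparr>"
    unfolding is_TT2_def by blast
  then show ?case using is_TT2_oriented by auto
next
  case (Suc j)
  then obtain T D :: "'a pair_pre_digraph"
    where TD: "is_TT2 T" "(is_triangle ^^ j) T D" "oriented_graph D" by blast
  interpret oriented_graph D by (fact TD(3))
  obtain u where u: "u \<notin> pverts D"
    using assms by (meson ex_new_if_finite pair_finite_verts)
  obtain v where v: "v \<notin> insert u (pverts D)"
    using assms by (meson ex_new_if_finite finite.insertI pair_finite_verts)
  obtain E where "is_triangle D E"
    using u v unfolding is_triangle_def by blast
  then show ?case using TD is_triangle_oriented by (metis relpowp_Suc_I)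
qed

end

theory Submission
  imports Defs "HOL-Library.Z2" "HOL-Library.Function_Algebras"
begin

text \<open>
  Let \<open>u\<^sub>i\<close>, \<open>v\<^sub>i\<close> be the \<open>i\<close>-th pair of
  vertices. A decycling family of size \<open>m\<close> gives every vertex an incidence vector of
  length \<open>m\<close> over the field with two elements, and the Gram matrix of these vectors is
  known off the diagonal: the entry of \<open>p\<close> and \<open>q\<close> is \<open>[p before q]
  + [p \<rightarrow> q]\<close>, with \<open>before\<close> referring to the resulting transitive
  order. Regard each pair as a chord on the points of this order, and put \<open>w\<^sub>i =
  u\<^sub>i + v\<^sub>i\<close>; then \<open>w\<^sub>j \<cdot> p\<close> only records whether
  \<open>p\<close> lies under chord \<open>j\<close> and whether its index is below
  \<open>j\<close>. Consequently, for \<open>z\<^sub>r = w\<^sub>r +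
  w\<^sub>r\<^sub>+\<^sub>1\<close>, the first point and every sum of two consecutive points are
  non-orthogonal to at most two of the \<open>z\<^sub>r\<close>, so the \<open>z\<^sub>r\<close>
  which are not orthogonal to all points contribute at least half their number to the rank. If
  \<open>z\<^sub>r\<close> is orthogonal to all points, then either both chords \<open>r\<close> and
  \<open>r + 1\<close> join consecutive points or an endpoint of one is next to an endpoint of the
  other; in both cases there is a vector orthogonal to all \<open>w\<^sub>j\<close> whose last
  non-orthogonal \<open>v\<^sub>l\<close> is at \<open>l = r\<close> or \<open>l = r + 1\<close>,
  and vectors with different \<open>l\<close> are independent. Together \<open>2m \<ge> k -
  1\<close>.
\<close>

section \<open>Bilinear form over the field with two elements, and ranks via triangular
  systems\<close>

definition dot :: "nat \<Rightarrow> (nat \<Rightarrow> bit) \<Rightarrow> (nat \<Rightarrow> bit) \<Rightarrow> bit" where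
  "dot m f g = (\<Sum>l<m. f l * g l)"

lemma dot_add_left [simp]: "dot m (f + f') g = dot m f g + dot m f' g"
  unfolding dot_def plus_fun_apply distrib_right sum.distrib ..

lemma dot_add_right [simp]: "dot m f (g + g') = dot m f g + dot m f g'"
  unfolding dot_def plus_fun_apply distrib_left sum.distrib ..

lemma dot_commute: "dot m f g = dot m g f"
  unfolding dot_def by (intro sum.cong refl mult.commute)

text \<open>Certifies that the second components are linearly independent: the first component of a
  pair detects its own partner and none of the later ones.\<close>

fun triangular :: "nat \<Rightarrow> ((nat \<Rightarrow> bit) \<times> (nat \<Rightarrow> bit)) list \<Rightarrow> bool" where
  "triangular m [] \<longleftrightarrow> True"
| "triangular m ((h, g) # ps) \<longleftrightarrow>
     dot m h g = 1 \<and> (\<forall>g' \<in> snd ` set ps. dot m h g' = 0) \<and> triangular m ps"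

text \<open>\<open>A\<close> is the span of the second components, cut off at coordinate
  \<open>m\<close>. Each new vector doubles it: the functional \<open>h\<close> is 0 on the old span
  and 1 on its translate, so the two are disjoint.\<close>

lemma triangular_span:
  assumes "triangular m ps"
  shows "\<exists>A :: (nat \<Rightarrow> bit) set. finite A \<and> card A = 2 ^ length ps \<and> (\<forall>f\<in>A. \<forall>l\<ge>m. f l = 0) \<and>
    (\<forall>h. (\<forall>g \<in> snd ` set ps. dot m h g = 0) \<longrightarrow> (\<forall>f\<in>A. dot m h f = 0))"
  using assms
proof (induction ps)
  case Nil
  show ?case
    by (rule exI[of _ "{0}"]) (simp add: dot_def)
next
  case (Cons p ps)
  obtain h g where p: "p = (h, g)" by force
  have "triangular m ps"
    using Cons.prems by (simp add: p)
  from Cons.IH[OF this] obtain A where A: "finite A" "card A = 2 ^ length ps" "\<forall>f\<in>A. \<forall>l\<ge>m. f l = 0"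
    "\<forall>h. (\<forall>g \<in> snd ` set ps. dot m h g = 0) \<longrightarrow> (\<forall>f\<in>A. dot m h f = 0)"
    by (elim exE conjE)
  \<comment> \<open>Values from \<open>m\<close> on are invisible to \<open>dot m\<close>; setting
    them to 0 allows the vectors to be counted later by their supports.\<close>
  define g0 where "g0 = (\<lambda>l. if l < m then g l else 0)"
  have g0: "dot m f g0 = dot m f g" for f
    unfolding dot_def by (rule sum.cong) (simp_all add: g0_def)
  have h: "dot m h g = 1" "\<forall>g \<in> snd ` set ps. dot m h g = 0"
    using Cons.prems unfolding p by simp_all
  have hA: "dot m h f = 0" if "f \<in> A" for f
    using A(4) h(2) that by blast
  have "inj_on ((+) g0) A"
    by simp
  then have "card ((+) g0 ` A) = 2 ^ length ps"
    using A(2) by (simp add: card_image)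
  moreover have "A \<inter> (+) g0 ` A = {}"
  proof (rule equals0I)
    fix f
    assume "f \<in> A \<inter> (+) g0 ` A"
    then obtain f' where "f' \<in> A" "f = g0 + f'" "f \<in> A"
      by blast
    with hA[of f] hA[of f'] h(1) show False
      by (simp add: g0)
  qed
  ultimately have "card (A \<union> (+) g0 ` A) = 2 ^ length (p # ps)"
    using A(1,2) by (simp add: card_Un_disjoint)
  moreover have "\<forall>f \<in> A \<union> (+) g0 ` A. \<forall>l\<ge>m. f l = 0"
    using A(3) by (auto simp: g0_def)
  moreover have "\<forall>h'. (\<forall>g \<in> snd ` set (p # ps). dot m h' g = 0) \<longrightarrow>
      (\<forall>f \<in> A \<union> (+) g0 ` A. dot m h' f = 0)"
  proof (intro allI impI ballI)
    fix h' f
    assume h': "\<forall>g \<in> snd ` set (p # ps). dot m h' g = 0" and f: "f \<in> A \<union> (+) g0 ` A"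
    then have "dot m h' g = 0" "\<forall>g \<in> snd ` set ps. dot m h' g = 0"
      by (simp_all add: p)
    moreover from this have "\<forall>f\<in>A. dot m h' f = 0"
      using A(4) by blast
    ultimately show "dot m h' f = 0"
      using f by (auto simp: g0)
  qed
  ultimately show ?case
    using A(1) by (intro exI[of _ "A \<union> (+) g0 ` A"]) blast
qed

text \<open>The span has \<open>2 ^ length ps\<close> vectors, and these have distinct supports
  inside \<open>{..<m}\<close>.\<close>

lemma triangular_length_le:
  assumes "triangular m ps"
  shows "length ps \<le> m"
proof -
  obtain A :: "(nat \<Rightarrow> bit) set"
    where A: "card A = 2 ^ length ps" "\<forall>f\<in>A. \<forall>l\<ge>m. f l = 0"
    using triangular_span[OF assms] by blast
  define \<phi> where "\<phi> = (\<lambda>f :: nat \<Rightarrow> bit. {l. f l \<noteq> 0})"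
  have "inj_on \<phi> A"
  proof (rule inj_onI, rule ext)
    fix f g :: "nat \<Rightarrow> bit" and l
    assume "\<phi> f = \<phi> g"
    then have "f l \<noteq> 0 \<longleftrightarrow> g l \<noteq> 0"
      by (auto simp: \<phi>_def)
    then show "f l = g l"
      by (cases "f l"; cases "g l") simp_all
  qed
  moreover have "\<phi> ` A \<subseteq> Pow {..<m}"
    using A(2) by (force simp: \<phi>_def not_le[symmetric])
  ultimately have "card A \<le> card (Pow {..<m})"
    using card_inj_on_le finite_Pow_iff finite_lessThan by blast
  then show ?thesis
    by (simp add: A(1) card_Pow)
qed

text \<open>Greedy choice: each new pair is led by a functional vanishing on everything chosen before,
  and makes at most two functionals of the pool unusable.\<close>

lemma triangular_extend:
  assumes "finite R" "triangular m ps"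
    and "\<And>r. r \<in> R \<Longrightarrow> \<exists>g. dot m (z r) g = 1 \<and> card {s \<in> R. dot m (z s) g \<noteq> 0} \<le> 2"
    and "\<And>r g. r \<in> R \<Longrightarrow> g \<in> snd ` set ps \<Longrightarrow> dot m (z r) g = 0"
  shows "\<exists>qs. triangular m qs \<and> 2 * length ps + card R \<le> 2 * length qs"
  using assms
proof (induction "card R" arbitrary: R ps rule: less_induct)
  case less
  show ?case
  proof (cases "R = {}")
    case True
    then show ?thesis using less.prems(2) by auto
  next
    case False
    then obtain r where r: "r \<in> R" by blast
    obtain g where g: "dot m (z r) g = 1" "card {s \<in> R. dot m (z s) g \<noteq> 0} \<le> 2"
      using less.prems(3)[OF r] by blast
    define R' where "R' = {s \<in> R. dot m (z s) g = 0}"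
    have fin: "finite R'" and sub: "R' \<subseteq> R"
      using less.prems(1) by (auto simp: R'_def)
    have "R = R' \<union> {s \<in> R. dot m (z s) g \<noteq> 0}"
      by (auto simp: R'_def)
    then have le: "card R \<le> card R' + 2"
      using g(2) card_Un_le[of R' "{s \<in> R. dot m (z s) g \<noteq> 0}"] by simp
    have lt: "card R' < card R"
    proof (rule psubset_card_mono[OF less.prems(1)])
      show "R' \<subset> R"
      proof -
        have "r \<notin> R'"
          using g(1) by (simp add: R'_def)
        then show ?thesis
          using r sub by blast
      qed
    qed
    have "\<exists>qs. triangular m qs \<and> 2 * length ((z r, g) # ps) + card R' \<le> 2 * length qs"
    proof (rule less.hyps[OF lt fin])
      show "triangular m ((z r, g) # ps)"
        using less.prems(2,4) r g(1) by simp
      show "\<exists>g. dot m (z s) g = 1 \<and> card {s \<in> R'. dot m (z s) g \<noteq> 0} \<le> 2" if s: "s \<in> R'" for s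
      proof -
        obtain g' where "dot m (z s) g' = 1" "card {s \<in> R. dot m (z s) g' \<noteq> 0} \<le> 2"
          using less.prems(3) s sub by blast
        moreover have "card {s \<in> R'. dot m (z s) g' \<noteq> 0} \<le> card {s \<in> R. dot m (z s) g' \<noteq> 0}"
          using sub less.prems(1) by (intro card_mono) auto
        ultimately show ?thesis by (meson le_trans)
      qed
      show "dot m (z s) g' = 0" if "s \<in> R'" "g' \<in> snd ` set ((z r, g) # ps)" for s g'
        using that less.prems(4) by (auto simp: R'_def)
    qed
    then show ?thesis using le by fastforce
  qed
qed

text \<open>Indices are added in increasing order, so the largest ends up at the head, where its
  functional kills the vectors of all smaller indices.\<close>

lemma triangular_sorted:
  fixes S :: "nat set"
  assumes "finite S"
    and "\<And>r. r \<in> S \<Longrightarrow> dot m (v r) (y r) = 1"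
    and "\<And>r s. r \<in> S \<Longrightarrow> s \<in> S \<Longrightarrow> s < r \<Longrightarrow> dot m (v r) (y s) = 0"
  shows "\<exists>ps. triangular m ps \<and> length ps = card S \<and> snd ` set ps = y ` S"
  using assms
proof (induction S rule: finite_linorder_max_induct)
  case empty
  then show ?case by (intro exI[of _ "[]"]) simp
next
  case (insert b S)
  then obtain ps where "triangular m ps" "length ps = card S" "snd ` set ps = y ` S"
    by auto
  moreover have "b \<notin> S" using insert.hyps(2) by blast
  ultimately show ?case
    using insert by (intro exI[of _ "(v b, y b) # ps"]) auto
qed

section \<open>Jumps of an almost constant sequence, and pairs of chords on a line\<close>

text \<open>Apart from its arbitrary values at \<open>a\<close> and \<open>b\<close>, the sequence
  \<open>e\<close> is the indicator of the interval between them. These two values only decide on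
  which side of each index a jump can lie.\<close>

lemma card_boundary_le_2:
  fixes e :: "nat \<Rightarrow> bit"
  assumes "\<And>j. j < k \<Longrightarrow> j \<noteq> a \<Longrightarrow> j \<noteq> b \<Longrightarrow> e j = of_bool (a < j) + of_bool (b < j)"
  shows "card {r. Suc r < k \<and> e r + e (Suc r) \<noteq> 0} \<le> 2"
proof -
  have *: "card {r. Suc r < k \<and> e r + e (Suc r) \<noteq> 0} \<le> 2"
    if e: "\<And>j. j < k \<Longrightarrow> j \<noteq> a \<Longrightarrow> j \<noteq> b \<Longrightarrow> e j = of_bool (a < j) + of_bool (b < j)"
      and "a \<le> b" for a b
  proof -
    \<comment> \<open>One candidate position for a jump at each of \<open>a\<close> and
      \<open>b\<close>. Truncation of \<open>a - 1\<close> or \<open>b - 1\<close> at 0 only adds a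
      harmless candidate.\<close>
    define P where "P = {if e a = 0 then a else a - 1, if e b = 0 then b - 1 else b}"
    have "r \<in> P" if r: "Suc r < k" "e r + e (Suc r) \<noteq> 0" for r
    proof (rule ccontr)
      assume "r \<notin> P"
      define E where "E j \<longleftrightarrow> e j = 1" for j
      have "\<not> E a \<Longrightarrow> r \<noteq> a" "E a \<Longrightarrow> Suc r \<noteq> a" "\<not> E b \<Longrightarrow> Suc r \<noteq> b" "E b \<Longrightarrow> r \<noteq> b"
        using \<open>r \<notin> P\<close> by (auto simp: P_def E_def)
      moreover have "E r \<longleftrightarrow> \<not> E (Suc r)"
        using r(2) unfolding E_def by (cases "e r"; cases "e (Suc r)") simp_all
      moreover have "E j \<longleftrightarrow> (a < j \<longleftrightarrow> \<not> b < j)" if "j < k" "j \<noteq> a" "j \<noteq> b" for j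
        using e[OF that] unfolding E_def by (cases "a < j"; cases "b < j") simp_all
      note this[of r] this[of "Suc r"]
      ultimately show False
        using r(1) \<open>a \<le> b\<close>
        by (cases "r = a"; cases "Suc r = a"; cases "r = b"; cases "Suc r = b") auto
    qed
    then have "card {r. Suc r < k \<and> e r + e (Suc r) \<noteq> 0} \<le> card P"
      by (intro card_mono subsetI) (simp add: P_def, blast)
    also have "card P \<le> 2"
      by (simp add: P_def card_insert_if)
    finally show ?thesis .
  qed
  show ?thesis
    using *[of a b] *[of b a] assms by (cases "a \<le> b") (auto simp: add.commute)
qed

lemma of_bool_add_bit: "of_bool P + of_bool Q = (of_bool (P \<noteq> Q) :: bit)"
  by simp

text \<open>\<open>False\<close> stands for \<open>u\<close> (dominated by the earlier pairs), \<open>True\<close> for \<open>v\<close> (dominating them).\<close>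

definition pair_arc :: "nat \<Rightarrow> bool \<Rightarrow> nat \<Rightarrow> bool \<Rightarrow> bool" where
  "pair_arc i a j b \<longleftrightarrow> i < j \<and> \<not> b \<or> j < i \<and> a \<or> i = j \<and> \<not> a \<and> b"

text \<open>The point right after the smaller left endpoint would lie under exactly one chord if it
  were no endpoint. So it is the other left endpoint, or it closes a short chord; in that case the
  point after the other left endpoint shows in the same way that the second chord is short.\<close>

lemma chords_adjacent:
  fixes a a' b b' N :: nat
  assumes "a < a'" "b < b'" "a' < N" "b' < N" "a \<noteq> b" "a \<noteq> b'" "a' \<noteq> b" "a' \<noteq> b'"
    and "\<And>t. t < N \<Longrightarrow> t \<notin> {a, a', b, b'} \<Longrightarrow> ((a < t) \<noteq> (a' < t)) \<longleftrightarrow> ((b < t) \<noteq> (b' < t))"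
  shows "a' = Suc a \<and> b' = Suc b \<or> b = Suc a \<and> b < a' \<or> a = Suc b \<and> a < b'"
proof (cases "a < b")
  case True
  then have sep: "a' \<noteq> Suc a \<Longrightarrow> b = Suc a"
    using assms(1-8) assms(9)[of "Suc a"] by fastforce
  show ?thesis
  proof (cases "b = Suc a")
    case True
    then show ?thesis
      using assms(1-8) by simp
  next
    case False
    then have "a' = Suc a"
      using sep by blast
    moreover from this have "Suc b < b' \<Longrightarrow> False"
      using assms(4-8) \<open>a < b\<close> assms(9)[of "Suc b"] by fastforce
    ultimately show ?thesis
      using assms(1,2) Suc_lessI by blast
  qed
next
  case False
  then have "b < a"
    using assms(5) by simp
  then have sep: "b' \<noteq> Suc b \<Longrightarrow> a = Suc b"
    using assms(1-8) assms(9)[of "Suc b"] by fastforce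
  show ?thesis
  proof (cases "a = Suc b")
    case True
    then show ?thesis
      using assms(1-8) by simp
  next
    case False
    then have "b' = Suc b"
      using sep by blast
    moreover from this have "Suc a < a' \<Longrightarrow> False"
      using assms(3,5-8) \<open>b < a\<close> assms(9)[of "Suc a"] by fastforce
    ultimately show ?thesis
      using assms(1,2) Suc_lessI by blast
  qed
qed

section \<open>Chord diagrams with a prescribed Gram matrix\<close>

text \<open>By \<open>gram\<close>, the parity of the number of sets containing two vertices is odd
  exactly when the linear order disagrees with the original arc. The diagonal stays unspecified,
  since a vertex may lie in any number of sets.\<close>

locale chord_diagram =
  fixes m k :: nat and x :: "nat \<Rightarrow> bool \<Rightarrow> nat \<Rightarrow> bit" and pos :: "nat \<Rightarrow> bool \<Rightarrow> nat"
  assumes pos_inj: "i < k \<Longrightarrow> j < k \<Longrightarrow> pos i a = pos j b \<Longrightarrow> i = j \<and> a = b"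
    and pos_less: "i < k \<Longrightarrow> pos i a < 2 * k"
    and pos_surj: "t < 2 * k \<Longrightarrow> \<exists>i<k. \<exists>a. pos i a = t"
    and gram: "i < k \<Longrightarrow> j < k \<Longrightarrow> i \<noteq> j \<or> a \<noteq> b \<Longrightarrow>
      dot m (x i a) (x j b) = of_bool (pos i a < pos j b) + of_bool (pair_arc i a j b)"
begin

definition w :: "nat \<Rightarrow> nat \<Rightarrow> bit" where
  "w j = x j False + x j True"

definition z :: "nat \<Rightarrow> nat \<Rightarrow> bit" where
  "z r = w r + w (Suc r)"

definition inside :: "nat \<Rightarrow> nat \<Rightarrow> bool" where
  "inside j t \<longleftrightarrow> (pos j False < t) \<noteq> (pos j True < t)"

text \<open>For \<open>j < i\<close> both vertices of pair \<open>j\<close> relate alike to the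
  point, so the arc terms cancel; for \<open>i < j\<close> exactly one of them dominates it. The
  order terms add up to \<open>inside\<close>.\<close>

lemma w_dot:
  assumes "i < k" "j < k" "i \<noteq> j"
  shows "dot m (w j) (x i b) = of_bool (inside j (pos i b)) + of_bool (i < j)"
  using assms unfolding w_def dot_add_left inside_def
  by (subst (1 2) gram) (auto simp: pair_arc_def of_bool_add_bit)

lemma pos_step:
  assumes "pos i' b' = Suc (pos i b)" "i < k" "i' < k" "j < k" "j \<noteq> i"
  shows "pos j a < pos i' b' \<longleftrightarrow> pos j a < pos i b"
proof -
  have "pos j a \<noteq> pos i b"
    using assms pos_inj by blast
  then show ?thesis
    using assms(1) by linarith
qed

lemma inside_step:
  assumes "pos i' b' = Suc (pos i b)" "i < k" "i' < k" "j < k" "j \<noteq> i"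
  shows "inside j (pos i' b') \<longleftrightarrow> inside j (pos i b)"
  using pos_step[OF assms] by (simp add: inside_def)

text \<open>No chord covers the first point, so only the comparison \<open>i < j\<close> is left. It
  jumps between \<open>i\<close> and \<open>Suc i\<close>, and the unknown diagonal value at
  \<open>j = i\<close> affects just \<open>r = i\<close> and \<open>Suc r = i\<close>.\<close>

lemma first_point:
  assumes "i < k" "pos i b = 0"
  shows "card {r. Suc r < k \<and> dot m (z r) (x i b) \<noteq> 0} \<le> 2"
proof -
  have "r = i \<or> r = i - 1" if "Suc r < k" "dot m (z r) (x i b) \<noteq> 0" for r
  proof (rule ccontr)
    assume *: "\<not> (r = i \<or> r = i - 1)"
    then have "dot m (z r) (x i b) = of_bool (i < r) + of_bool (i < Suc r)"
      unfolding z_def dot_add_left using that(1) assms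
      by (subst (1 2) w_dot) (auto simp: inside_def)
    with * that show False
      by (auto simp: of_bool_add_bit)
  qed
  then have "card {r. Suc r < k \<and> dot m (z r) (x i b) \<noteq> 0} \<le> card {i, i - 1}"
    by (intro card_mono subsetI) auto
  also have "\<dots> \<le> 2"
    by (simp add: card_insert_if)
  finally show ?thesis .
qed

text \<open>Every chord of another pair covers both points or neither, so the covering terms cancel
  and the two index comparisons remain.\<close>

lemma consecutive_points:
  assumes "i < k" "i' < k" "pos i' b' = Suc (pos i b)"
  shows "card {r. Suc r < k \<and> dot m (z r) (x i b + x i' b') \<noteq> 0} \<le> 2"
  unfolding z_def dot_add_left
proof (rule card_boundary_le_2)
  fix j
  assume "j < k" "j \<noteq> i" "j \<noteq> i'"
  with assms show "dot m (w j) (x i b + x i' b') = of_bool (i < j) + of_bool (i' < j)"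
    unfolding dot_add_right using inside_step[of i' b' i b j]
    by (subst (1 2) w_dot) (auto simp: of_bool_add_bit)
qed

text \<open>Take the first point that is not orthogonal to \<open>z r\<close>: either it is the
  first of all points, or its predecessor is orthogonal to \<open>z r\<close> and the sum of the two
  serves.\<close>

lemma generator:
  assumes "i < k" "dot m (z r) (x i b) \<noteq> 0"
  shows "\<exists>g. dot m (z r) g = 1 \<and> card {s. Suc s < k \<and> dot m (z s) g \<noteq> 0} \<le> 2"
proof -
  define P where "P t \<longleftrightarrow> (\<exists>i<k. \<exists>b. pos i b = t \<and> dot m (z r) (x i b) \<noteq> 0)" for t
  have "P (pos i b)"
    using assms unfolding P_def by blast
  then have "P (LEAST t. P t)"
    by (rule LeastI)
  then obtain i b where ib: "i < k" "pos i b = (LEAST t. P t)" "dot m (z r) (x i b) \<noteq> 0"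
    unfolding P_def by blast
  show ?thesis
  proof (cases "pos i b")
    case 0
    then show ?thesis
      using ib first_point by (intro exI[of _ "x i b"]) simp
  next
    case (Suc t)
    then obtain i' b' where i'b': "i' < k" "pos i' b' = t"
      using pos_surj[of t] pos_less[OF ib(1), of b] by auto
    have "\<not> P t"
      using not_less_Least[of t P] Suc ib(2) by simp
    then have "dot m (z r) (x i' b') = 0"
      using i'b' unfolding P_def by blast
    then show ?thesis
      using ib i'b' Suc consecutive_points[of i' i b b']
      by (intro exI[of _ "x i' b' + x i b"]) simp
  qed
qed

section \<open>Vectors orthogonal to all chords\<close>

text \<open>The condition on \<open>a > l\<close> makes vectors with different \<open>l\<close> a
  triangular system; orthogonality to all \<open>w j\<close> makes every \<open>z r\<close> vanish
  on them.\<close>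

definition kernel_lead :: "nat \<Rightarrow> (nat \<Rightarrow> bit) \<Rightarrow> bool" where
  "kernel_lead l y \<longleftrightarrow> l < k \<and> (\<forall>j<k. dot m (w j) y = 0) \<and>
     dot m (x l True) y = 1 \<and> (\<forall>a<k. l < a \<longrightarrow> dot m (x a True) y = 0)"

text \<open>Being adjacent, the two points look alike to all other chords, and vertices of later
  pairs have the same arc relation to both.\<close>

lemma kernel_lead_parallel:
  assumes r: "Suc r < k"
    and z0: "\<And>i b. i < k \<Longrightarrow> dot m (z r) (x i b) = 0"
    and adj: "pos (Suc r) f = Suc (pos r e) \<or> pos r e = Suc (pos (Suc r) f)"
    and ins: "inside (Suc r) (pos r e) \<longleftrightarrow> \<not> inside r (pos (Suc r) f)"
  shows "kernel_lead (Suc r) (x r e + x (Suc r) f)"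
proof -
  define y where "y = x r e + x (Suc r) f"
  have cmp: "pos j a < pos r e \<longleftrightarrow> pos j a < pos (Suc r) f"
    if "j < k" "(j, a) \<noteq> (r, e)" "(j, a) \<noteq> (Suc r, f)" for j a
  proof -
    have "pos j a \<noteq> pos r e" "pos j a \<noteq> pos (Suc r) f"
      using that r Suc_lessD[OF r] pos_inj by blast+
    then show ?thesis
      using adj by linarith
  qed
  have eq: "dot m (w r) (x i b) = dot m (w (Suc r)) (x i b)" if "i < k" for i b
    using z0[OF that, of b] unfolding z_def dot_add_left
    by (cases "dot m (w r) (x i b)"; cases "dot m (w (Suc r)) (x i b)") simp_all
  \<comment> \<open>By \<open>eq\<close> the unknown diagonal term can be replaced:
    \<open>w (Suc r)\<close> is evaluated at \<open>x r e\<close> and \<open>w r\<close> at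
    \<open>x (Suc r) f\<close>. The index comparisons contribute 1, and by \<open>ins\<close> so do
    the covering terms.\<close>
  have wS: "dot m (w (Suc r)) y = 0"
    unfolding y_def dot_add_right using r ins
    by (subst eq[symmetric], simp, subst (1 2) w_dot) (auto simp: of_bool_add_bit)
  have w0: "dot m (w j) y = 0" if "j < k" for j
  proof -
    consider "j = r" | "j = Suc r" | "j \<noteq> r" "j \<noteq> Suc r" by blast
    then show ?thesis
    proof cases
      case 1
      then show ?thesis
        using wS eq r unfolding y_def dot_add_right by simp
    next
      case 2
      then show ?thesis using wS by simp
    next
      case 3
      then have "inside j (pos r e) \<longleftrightarrow> inside j (pos (Suc r) f)"
        using cmp that by (simp add: inside_def)
      then show ?thesis
        unfolding y_def dot_add_right using 3 that r
        by (subst (1 2) w_dot) (auto simp: of_bool_add_bit)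
    qed
  qed
  \<comment> \<open>The partner \<open>\<not> f\<close> is tested because the product of
    \<open>x (Suc r) f\<close> with itself is unknown; orthogonality to \<open>w (Suc r)\<close>
    gives both vertices of the pair the same value.\<close>
  have "dot m (x (Suc r) (\<not> f)) y = 1"
    unfolding y_def dot_add_right using r cmp[of "Suc r" "\<not> f"]
    by (subst (1 2) gram) (auto simp: pair_arc_def of_bool_add_bit)
  moreover have "dot m (x (Suc r) False) y = dot m (x (Suc r) True) y"
    using w0[OF r] unfolding w_def dot_add_left
    by (cases "dot m (x (Suc r) False) y"; cases "dot m (x (Suc r) True) y") simp_all
  ultimately have "dot m (x (Suc r) True) y = 1"
    by (cases f) simp_all
  moreover have "dot m (x a True) y = 0" if "a < k" "Suc r < a" for a
    unfolding y_def dot_add_right using that r cmp[of a True]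
    by (subst (1 2) gram) (auto simp: pair_arc_def of_bool_add_bit)
  ultimately show ?thesis
    using w0 r unfolding kernel_lead_def y_def by blast
qed

lemma inside_iff: "inside j t \<longleftrightarrow> (pos j c < t) \<noteq> (pos j (\<not> c) < t)"
  by (cases c) (auto simp: inside_def)

lemma inside_short:
  assumes "pos j (\<not> c) = Suc (pos j c)" "i < k" "j < k" "i \<noteq> j"
  shows "\<not> inside j (pos i b)"
proof -
  have "pos i b \<noteq> pos j (\<not> c)"
    using assms pos_inj by blast
  then show ?thesis
    using assms(1) unfolding inside_iff[of j _ c] by linarith
qed

text \<open>Short chords cover no point of another pair, so only index comparisons survive, and
  equality of the products with \<open>w r\<close> and \<open>w (Suc r)\<close> supplies the
  diagonal. The result is the same for both vertices of a pair, hence cancels in every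
  \<open>w j\<close>.\<close>

lemma kernel_lead_short:
  assumes r: "Suc r < k"
    and z0: "\<And>i b. i < k \<Longrightarrow> dot m (z r) (x i b) = 0"
    and short: "pos r (\<not> c) = Suc (pos r c)" "pos (Suc r) (\<not> d) = Suc (pos (Suc r) d)"
  shows "kernel_lead r (w (Suc r))"
proof -
  have eq: "dot m (w (Suc r)) (x i b) = dot m (w r) (x i b)" if "i < k" for i b
    using z0[OF that, of b] unfolding z_def dot_add_left
    by (cases "dot m (w r) (x i b)"; cases "dot m (w (Suc r)) (x i b)") simp_all
  have val: "dot m (w (Suc r)) (x i b) = of_bool (i \<le> r)" if "i < k" for i b
  proof (cases "i = Suc r")
    case True
    then show ?thesis
      using r eq[OF that] w_dot[of i r b] inside_short[OF short(1), of i b] by simp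
  next
    case False
    then show ?thesis
      using r that w_dot[of i "Suc r" b] inside_short[OF short(2), of i b]
      by (simp add: less_Suc_eq_le)
  qed
  have "dot m (w j) (w (Suc r)) = 0" if "j < k" for j
    unfolding w_def[of j] dot_add_left
    by (subst (1 2) dot_commute) (simp add: val[OF that])
  moreover have "dot m (x a True) (w (Suc r)) = of_bool (a \<le> r)" if "a < k" for a
    by (subst dot_commute) (simp add: val[OF that])
  ultimately show ?thesis
    using r by (simp add: kernel_lead_def)
qed

text \<open>At a point off both chords the index terms of \<open>w r\<close> and
  \<open>w (Suc r)\<close> agree, so orthogonality to \<open>z r\<close> means that the point lies
  under both chords or neither; \<open>chords_adjacent\<close> leaves three configurations.\<close>

lemma exists_kernel_lead:
  assumes r: "Suc r < k"
    and z0: "\<And>i b. i < k \<Longrightarrow> dot m (z r) (x i b) = 0"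
  shows "\<exists>y. kernel_lead r y \<or> kernel_lead (Suc r) y"
proof -
  have lt: "\<exists>c. pos j c < pos j (\<not> c)" if "j < k" for j
    using pos_inj[OF that that, of False True] nat_neq_iff by (metis (full_types))
  \<comment> \<open>Either vertex of a pair may come first in the order; \<open>c\<close> and
    \<open>d\<close> pick the left endpoints.\<close>
  obtain c where c: "pos r c < pos r (\<not> c)"
    using lt r by (meson Suc_lessD)
  obtain d where d: "pos (Suc r) d < pos (Suc r) (\<not> d)"
    using lt r by blast
  have "((pos r c < t) \<noteq> (pos r (\<not> c) < t)) \<longleftrightarrow> ((pos (Suc r) d < t) \<noteq> (pos (Suc r) (\<not> d) < t))"
    if t: "t < 2 * k" "t \<notin> {pos r c, pos r (\<not> c), pos (Suc r) d, pos (Suc r) (\<not> d)}" for t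
  proof -
    obtain i b where i: "i < k" "pos i b = t"
      using pos_surj t(1) by blast
    then have "i \<noteq> r" "i \<noteq> Suc r"
      using t(2) by (cases b; cases c; cases d; auto)+
    then have "inside r t \<longleftrightarrow> inside (Suc r) t"
      using z0[OF i(1), of b] i r w_dot[of i r b] w_dot[of i "Suc r" b]
      unfolding z_def dot_add_left by (auto simp: of_bool_add_bit)
    then show ?thesis
      by (simp only: inside_iff[of r t c] inside_iff[of "Suc r" t d])
  qed
  moreover have "pos r a \<noteq> pos (Suc r) b" for a b
    using pos_inj[of r "Suc r" a b] r by auto
  ultimately have "pos r (\<not> c) = Suc (pos r c) \<and> pos (Suc r) (\<not> d) = Suc (pos (Suc r) d) \<or>
      pos (Suc r) d = Suc (pos r c) \<and> pos (Suc r) d < pos r (\<not> c) \<or>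
      pos r c = Suc (pos (Suc r) d) \<and> pos r c < pos (Suc r) (\<not> d)"
    using c d r pos_less by (intro chords_adjacent[where N = "2 * k"]) auto
  then show ?thesis
  proof (elim disjE conjE)
    assume "pos r (\<not> c) = Suc (pos r c)" "pos (Suc r) (\<not> d) = Suc (pos (Suc r) d)"
    then show ?thesis
      using kernel_lead_short[OF r z0] by blast
  next
    assume *: "pos (Suc r) d = Suc (pos r c)" "pos (Suc r) d < pos r (\<not> c)"
    then have "kernel_lead (Suc r) (x r c + x (Suc r) d)"
      using d by (intro kernel_lead_parallel[OF r z0])
        (auto simp: inside_iff[of r _ c] inside_iff[of "Suc r" _ d])
    then show ?thesis by blast
  next
    assume *: "pos r c = Suc (pos (Suc r) d)" "pos r c < pos (Suc r) (\<not> d)"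
    then have "kernel_lead (Suc r) (x r c + x (Suc r) d)"
      using c by (intro kernel_lead_parallel[OF r z0])
        (auto simp: inside_iff[of r _ c] inside_iff[of "Suc r" _ d])
    then show ?thesis by blast
  qed
qed

section \<open>Counting independent vectors\<close>

lemma dimension_bound: "k - 1 \<le> 2 * m"
proof -
  define S where "S = {l. \<exists>y. kernel_lead l y}"
  define R0 where "R0 = {r. Suc r < k \<and> (\<forall>i<k. \<forall>b. dot m (z r) (x i b) = 0)}"
  define R1 where "R1 = {r. Suc r < k \<and> (\<exists>i<k. \<exists>b. dot m (z r) (x i b) \<noteq> 0)}"
  define y where "y l = (SOME y. kernel_lead l y)" for l
  have y: "kernel_lead l (y l)" if "l \<in> S" for l
    using that someI_ex[of "kernel_lead l"] by (simp add: S_def y_def)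
  have "S \<subseteq> {..<k}"
    by (auto simp: S_def kernel_lead_def)
  then have fin: "finite S"
    by (rule finite_subset) simp
  have fin1: "finite R1"
    by (rule finite_subset[of _ "{..<k}"]) (auto simp: R1_def)
  have fin0: "finite R0"
    by (rule finite_subset[of _ "{..<k}"]) (auto simp: R0_def)
  \<comment> \<open>A lead \<open>l\<close> accounts for at most two members of \<open>R0\<close>,
    namely \<open>l\<close> and \<open>l - 1\<close>, which costs the factor 2.\<close>
  have "R0 \<subseteq> S \<union> Suc -` S"
    using exists_kernel_lead by (auto simp: R0_def S_def) blast
  then have "card R0 \<le> card S + card (Suc -` S)"
    using fin card_mono[of "S \<union> Suc -` S" R0] card_Un_le[of S "Suc -` S"]
    by (simp add: finite_vimageI)
  also have "card (Suc -` S) \<le> card S"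
    using card_vimage_inj_on_le[of Suc UNIV S] fin by simp
  finally have S: "card R0 \<le> 2 * card S" by simp
  have "\<exists>ps. triangular m ps \<and> length ps = card S \<and> snd ` set ps = y ` S"
    using y by (intro triangular_sorted[OF fin, of _ "\<lambda>l. x l True"]) (auto simp: kernel_lead_def)
  then obtain ps where ps: "triangular m ps" "length ps = card S" "snd ` set ps = y ` S"
    by blast
  \<comment> \<open>The functionals \<open>z r\<close> vanish on the kernel vectors, so the greedy
    system can be put in front of \<open>ps\<close> and the two ranks add.\<close>
  have "\<exists>qs. triangular m qs \<and> 2 * length ps + card R1 \<le> 2 * length qs"
  proof (rule triangular_extend[OF fin1 ps(1)])
    fix r
    assume "r \<in> R1"
    then obtain g where g: "dot m (z r) g = 1" "card {s. Suc s < k \<and> dot m (z s) g \<noteq> 0} \<le> 2"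
      using generator unfolding R1_def by blast
    have "card {s \<in> R1. dot m (z s) g \<noteq> 0} \<le> card {s. Suc s < k \<and> dot m (z s) g \<noteq> 0}"
      by (rule card_mono) (auto simp: R1_def intro: finite_subset[of _ "{..<k}"])
    then show "\<exists>g. dot m (z r) g = 1 \<and> card {s \<in> R1. dot m (z s) g \<noteq> 0} \<le> 2"
      using g by (meson le_trans)
  next
    fix r g
    assume "r \<in> R1" "g \<in> snd ` set ps"
    then show "dot m (z r) g = 0"
      using y unfolding ps(3) by (auto simp: R1_def z_def kernel_lead_def)
  qed
  then obtain qs where qs: "triangular m qs" "2 * card S + card R1 \<le> 2 * length qs"
    using ps(2) by auto
  have "R0 \<union> R1 = {..<k - 1}" "R0 \<inter> R1 = {}"
    unfolding R0_def R1_def by (auto simp: less_diff_conv)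
  then have "card R0 + card R1 = k - 1"
    using fin0 fin1 by (metis card_Un_disjoint card_lessThan)
  then show ?thesis
    using S qs(2) triangular_length_le[OF qs(1)] by linarith
qed

end

section \<open>Inversions and acyclicity\<close>

lemma pverts_Inv [simp]: "pverts (Inv D Xs) = pverts D"
  by (induction Xs arbitrary: D) (auto simp: Inv_def invert_def)

lemma parcs_invert:
  "(a, b) \<in> parcs (invert X D) \<longleftrightarrow> (if a \<in> X \<and> b \<in> X then (b, a) else (a, b)) \<in> parcs D"
  by (force simp: invert_def image_iff split: if_splits)

lemma parcs_Inv:
  "(a, b) \<in> parcs (Inv D Xs) \<longleftrightarrow>
     (if even (length (filter (\<lambda>X. a \<in> X \<and> b \<in> X) Xs)) then (a, b) else (b, a)) \<in> parcs D"
proof (induction Xs arbitrary: D)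
  case Nil
  then show ?case by (simp add: Inv_def)
next
  case (Cons X Xs)
  have "Inv D (X # Xs) = Inv (invert X D) Xs"
    by (simp add: Inv_def)
  then show ?case
    using Cons[of "invert X D"] by (auto simp: parcs_invert)
qed

text \<open>In a tournament, excluding directed triangles already makes the arc relation
  transitive.\<close>

lemma acyclic_digraph_no_triangle:
  assumes "acyclic_digraph D" "a \<in> pverts D" "a \<noteq> b" "b \<noteq> c" "a \<noteq> c"
    and "(a, b) \<in> parcs D" "(b, c) \<in> parcs D"
  shows "(c, a) \<notin> parcs D"
proof
  assume "(c, a) \<in> parcs D"
  then have "pre_digraph.cycle (with_proj D) [(a, b), (b, c), (c, a)]"
    using assms(2-7) unfolding pre_digraph.cycle_def pre_digraph.awalk_def
    by (intro exI[of _ a]) (auto simp: cas_with_proj_eq awalk_verts_with_proj_eq)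
  then show False
    using assms(1) unfolding acyclic_digraph_def by blast
qed

text \<open>A nonempty walk ends strictly higher than it starts, so it cannot be closed.\<close>

lemma acyclic_digraphI:
  fixes h :: "'a \<Rightarrow> nat"
  assumes "\<And>a b. (a, b) \<in> parcs D \<Longrightarrow> h a < h b"
  shows "acyclic_digraph D"
proof -
  have *: "h u \<le> h v \<and> (p \<noteq> [] \<longrightarrow> h u < h v)" if "pcas u p v" "set p \<subseteq> parcs D" for u p v
    using that
  proof (induction p arbitrary: u)
    case Nil
    then show ?case by simp
  next
    case (Cons e p)
    then have "h (fst e) < h (snd e)" "fst e = u" "h (snd e) \<le> h v"
      using assms[of "fst e" "snd e"] by auto
    then show ?case by simp
  qed
  show ?thesis
    unfolding acyclic_digraph_def pre_digraph.cycle_def pre_digraph.awalk_def cas_with_proj_eq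
    using * by fastforce
qed

text \<open>Number the vertices and invert the end-vertex set of each descending arc; every such arc
  lies in exactly one of these sets and every other arc in none. This guarantees that the infimum in
  \<open>inversion_number\<close> is attained.\<close>

lemma exists_decycling_family:
  assumes "oriented_graph D"
  shows "\<exists>Xs. decycling_family D Xs"
proof -
  interpret oriented_graph D by fact
  obtain h :: "'a \<Rightarrow> nat" where h: "inj_on h (pverts D)"
    using finite_imp_inj_to_nat_seg[OF pair_finite_verts] by blast
  define B where "B = {e \<in> parcs D. h (snd e) < h (fst e)}"
  obtain es where es: "set es = B" "distinct es"
    using finite_distinct_list[of B] pair_finite_arcs by (auto simp: B_def)
  define Xs where "Xs = map (\<lambda>e. {fst e, snd e}) es"
  have count: "length (filter (\<lambda>X. a \<in> X \<and> b \<in> X) Xs) = of_bool (h b < h a)"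
    if ab: "(a, b) \<in> parcs D" for a b
  proof -
    have ne: "a \<noteq> b"
      using ab no_loops by fastforce
    have "{e \<in> B. a \<in> {fst e, snd e} \<and> b \<in> {fst e, snd e}} = (if h b < h a then {(a, b)} else {})"
      using ab ne arcs_asym[OF ab] by (auto simp: B_def)
    moreover have "length (filter (\<lambda>X. a \<in> X \<and> b \<in> X) Xs) =
        card {e \<in> B. a \<in> {fst e, snd e} \<and> b \<in> {fst e, snd e}}"
      using distinct_card[OF distinct_filter[OF es(2)], of "\<lambda>e. a \<in> {fst e, snd e} \<and> b \<in> {fst e, snd e}"]
      by (simp add: Xs_def filter_map o_def es(1))
    ultimately show ?thesis by simp
  qed
  have count': "length (filter (\<lambda>X. b \<in> X \<and> a \<in> X) Xs) = of_bool (h b < h a)"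
    if "(a, b) \<in> parcs D" for a b
    using count[OF that] by (simp add: conj_commute)
  have "acyclic_digraph (Inv D Xs)"
  proof (rule acyclic_digraphI)
    fix a b
    assume "(a, b) \<in> parcs (Inv D Xs)"
    then have "(a, b) \<in> parcs D \<and> \<not> h b < h a \<or> (b, a) \<in> parcs D \<and> h a < h b"
      using count[of a b] count'[of b a] by (auto simp: parcs_Inv split: if_splits)
    moreover have "h a \<noteq> h b" if "(a, b) \<in> parcs D"
      using that inj_onD[OF h] no_loops in_arcsD1 in_arcsD2 by fastforce
    ultimately show "h a < h b"
      by linarith
  qed
  moreover have "\<forall>X \<in> set Xs. X \<subseteq> pverts D"
    using arc_fst_in_verts arc_snd_in_verts by (auto simp: Xs_def es(1) B_def)
  ultimately show ?thesis
    unfolding decycling_family_def by blast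
qed

section \<open>Coordinates on iterated triangles\<close>

text \<open>Pair 0 is the initial arc and each iteration appends one pair, so there are
  \<open>n + 1\<close> pairs. The inclusion of the arcs in \<open>pverts D \<times> pverts D\<close>
  is carried through the induction to ensure that new vertices meet no old arc.\<close>

lemma iterated_triangle_coordinates:
  assumes "is_TT2 T" "(is_triangle ^^ n) T D"
  shows "\<exists>f. inj_on (\<lambda>(i, a). f i a) ({..n} \<times> UNIV) \<and>
    pverts D = (\<lambda>(i, a). f i a) ` ({..n} \<times> UNIV) \<and> parcs D \<subseteq> pverts D \<times> pverts D \<and>
    (\<forall>i\<le>n. \<forall>j\<le>n. \<forall>a b. (f i a, f j b) \<in> parcs D \<longleftrightarrow> pair_arc i a j b)"
  using assms(2)
proof (induction n arbitrary: D)
  case 0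
  then have "is_TT2 D"
    using assms(1) by simp
  then obtain u v where "u \<noteq> v" "D = \<lparr>pverts = {u, v}, parcs = {(u, v)}\<rparr>"
    unfolding is_TT2_def by blast
  then show ?case
    by (intro exI[of _ "\<lambda>_ a. if a then v else u"])
      (auto simp: inj_on_def pair_arc_def image_iff split: if_splits)
next
  case (Suc n)
  then obtain C where C: "(is_triangle ^^ n) T C" "is_triangle C D"
    by (auto elim: relpowp_Suc_E)
  obtain f where f: "inj_on (\<lambda>(i, a). f i a) ({..n} \<times> UNIV)"
    "pverts C = (\<lambda>(i, a). f i a) ` ({..n} \<times> UNIV)" "parcs C \<subseteq> pverts C \<times> pverts C"
    "\<forall>i\<le>n. \<forall>j\<le>n. \<forall>a b. (f i a, f j b) \<in> parcs C \<longleftrightarrow> pair_arc i a j b"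
    using Suc.IH[OF C(1)] by (elim exE conjE)
  obtain u v where uv: "u \<notin> pverts C" "v \<notin> pverts C" "u \<noteq> v"
    and D: "D = \<lparr>pverts = pverts C \<union> {u, v},
          parcs = parcs C \<union> pverts C \<times> {u} \<union> {(u, v)} \<union> {v} \<times> pverts C\<rparr>"
    using C(2) unfolding is_triangle_def by blast
  define g where "g i a = (if i = Suc n then if a then v else u else f i a)" for i a
  have g: "g i a = f i a" if "i \<le> n" for i a
    using that by (simp add: g_def)
  have gS: "g (Suc n) True = v" "g (Suc n) False = u"
    by (simp_all add: g_def)
  have mem: "f i a \<in> pverts C" if "i \<le> n" for i a
    using that f(2) by force
  have ne: "f i a \<noteq> u" "f i a \<noteq> v" "u \<noteq> f i a" "v \<noteq> f i a" if "i \<le> n" for i a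
    using mem[OF that, of a] uv by auto
  have fresh: "(u, y) \<notin> parcs C" "(v, y) \<notin> parcs C" "(y, u) \<notin> parcs C" "(y, v) \<notin> parcs C" for y
    using f(3) uv by auto
  have dom: "{..Suc n} \<times> (UNIV :: bool set) = {..n} \<times> UNIV \<union> {(Suc n, True), (Suc n, False)}"
    by (auto simp: le_Suc_eq)
  have img: "(\<lambda>(i, a). g i a) ` ({..n} \<times> UNIV) = pverts C"
    unfolding f(2) by (rule image_cong) (auto simp: g)
  have "inj_on (\<lambda>(i, a). g i a) ({..n} \<times> UNIV)"
    using f(1) by (rule iffD1[OF inj_on_cong, rotated]) (auto simp: g)
  then have "inj_on (\<lambda>(i, a). g i a) ({..Suc n} \<times> UNIV)"
    unfolding dom using uv img by (subst inj_on_Un) (auto simp: gS)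
  moreover have "pverts D = (\<lambda>(i, a). g i a) ` ({..Suc n} \<times> UNIV)"
    unfolding dom image_Un img by (auto simp: D gS)
  moreover have "parcs D \<subseteq> pverts D \<times> pverts D"
    using f(3) by (auto simp: D)
  moreover have "(g i a, g j b) \<in> parcs D \<longleftrightarrow> pair_arc i a j b" if ij: "i \<le> Suc n" "j \<le> Suc n" for i j a b
  proof -
    consider "i \<le> n" "j \<le> n" | "i \<le> n" "j = Suc n" | "i = Suc n" "j \<le> n" | "i = Suc n" "j = Suc n"
      using ij by (auto simp: le_Suc_eq)
    then show ?thesis
    proof cases
      case 1
      then show ?thesis
        using ne by (simp add: D g f(4))
    next
      case 2
      then show ?thesis
        using ne mem uv by (cases b) (simp_all add: D g gS pair_arc_def fresh)
    next
      case 3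
      then show ?thesis
        using ne mem uv by (cases a) (simp_all add: D g gS pair_arc_def fresh)
    next
      case 4
      then show ?thesis
        using uv by (cases a; cases b) (simp_all add: D gS pair_arc_def fresh)
    qed
  qed
  ultimately show ?case by blast
qed

lemma iterated_triangle_oriented:
  assumes "is_TT2 T" "(is_triangle ^^ n) T D"
  shows "oriented_graph D"
  using assms(2)
  by (induction n arbitrary: D) (auto intro: is_TT2_oriented[OF assms(1)] is_triangle_oriented elim: relpowp_Suc_E)

section \<open>From decycling families to chord diagrams\<close>

text \<open>The rank of an element is its number of predecessors, which grows strictly along the
  relation.\<close>

lemma exists_ranking:
  assumes "finite V"
    and irrefl: "\<And>a. a \<in> V \<Longrightarrow> (a, a) \<notin> r"
    and trans: "\<And>a b c. a \<in> V \<Longrightarrow> b \<in> V \<Longrightarrow> c \<in> V \<Longrightarrow> (a, b) \<in> r \<Longrightarrow> (b, c) \<in> r \<Longrightarrow> (a, c) \<in> r"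
    and total: "\<And>a b. a \<in> V \<Longrightarrow> b \<in> V \<Longrightarrow> a \<noteq> b \<Longrightarrow> (a, b) \<in> r \<or> (b, a) \<in> r"
  shows "\<exists>h. bij_betw h V {..<card V} \<and> (\<forall>a\<in>V. \<forall>b\<in>V. h a < h b \<longleftrightarrow> (a, b) \<in> r)"
proof -
  define h where "h a = card {c \<in> V. (c, a) \<in> r}" for a
  have mono: "h a < h b" if "a \<in> V" "b \<in> V" "(a, b) \<in> r" for a b
    unfolding h_def
  proof (rule psubset_card_mono)
    show "finite {c \<in> V. (c, b) \<in> r}"
      using assms(1) by simp
    show "{c \<in> V. (c, a) \<in> r} \<subset> {c \<in> V. (c, b) \<in> r}"
      using that irrefl trans by blast
  qed
  have iff: "h a < h b \<longleftrightarrow> (a, b) \<in> r" if "a \<in> V" "b \<in> V" for a b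
    using mono[OF that] mono[OF that(2,1)] total[OF that] by fastforce
  have "inj_on h V"
  proof (rule inj_onI)
    fix a b
    assume "a \<in> V" "b \<in> V" "h a = h b"
    then show "a = b"
      using total[of a b] mono[of a b] mono[of b a] by fastforce
  qed
  moreover have "h ` V \<subseteq> {..<card V}"
  proof (rule image_subsetI)
    fix a
    assume "a \<in> V"
    then have "{c \<in> V. (c, a) \<in> r} \<subset> V"
      using irrefl by blast
    then show "h a \<in> {..<card V}"
      using assms(1) by (simp add: h_def psubset_card_mono)
  qed
  ultimately have "bij_betw h V {..<card V}"
    by (simp add: bij_betw_def card_image card_subset_eq)
  then show ?thesis
    using iff by blast
qed

lemma sum_of_bool_nth:
  "(\<Sum>l<length Xs. of_bool (P (Xs ! l))) = (of_bool (odd (length (filter P Xs))) :: bit)"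
  by (induction Xs) (simp_all add: sum.lessThan_Suc_shift del: sum.lessThan_Suc)

text \<open>Since \<open>D\<close> is a tournament, the acyclic result of the inversions is a
  transitive tournament and ranks the vertices. Their incidence vectors in \<open>Xs\<close> form a
  chord diagram with \<open>Suc n\<close> pairs.\<close>

lemma decycling_family_length:
  assumes "is_TT2 T" "(is_triangle ^^ n) T D" "decycling_family D Xs"
  shows "n \<le> 2 * length Xs"
proof -
  obtain f where f_inj: "inj_on (\<lambda>(i, a). f i a) ({..n} \<times> UNIV)"
    and V: "pverts D = (\<lambda>(i, a). f i a) ` ({..n} \<times> UNIV)"
    and arcs: "parcs D \<subseteq> pverts D \<times> pverts D"
    and f_arc: "\<forall>i\<le>n. \<forall>j\<le>n. \<forall>a b. (f i a, f j b) \<in> parcs D \<longleftrightarrow> pair_arc i a j b"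
    using iterated_triangle_coordinates[OF assms(1,2)] by (elim exE conjE)
  interpret oriented_graph D
    using iterated_triangle_oriented[OF assms(1,2)] .
  define odds where "odds p q \<longleftrightarrow> odd (length (filter (\<lambda>X. p \<in> X \<and> q \<in> X) Xs))" for p q
  have odds_sym: "odds p q \<longleftrightarrow> odds q p" for p q
    by (simp add: odds_def conj_commute)
  define r where "r = parcs (Inv D Xs)"
  have r: "(p, q) \<in> r \<longleftrightarrow> (if odds p q then (q, p) else (p, q)) \<in> parcs D" for p q
    by (simp add: r_def odds_def parcs_Inv)
  have f_eq: "f i a = f j b \<longleftrightarrow> i = j \<and> a = b" if "i \<le> n" "j \<le> n" for i j a b
    using that inj_onD[OF f_inj, of "(i, a)" "(j, b)"] by auto
  have mem: "f i a \<in> pverts D" if "i \<le> n" for i a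
    using that V by force
  have tour: "(q, p) \<in> parcs D \<longleftrightarrow> (p, q) \<notin> parcs D"
    if pq: "p \<in> pverts D" "q \<in> pverts D" "p \<noteq> q" for p q
  proof -
    obtain i a j b where "p = f i a" "q = f j b" "i \<le> n" "j \<le> n"
      using pq unfolding V by auto
    with \<open>p \<noteq> q\<close> less_linear[of i j] show ?thesis
      by (cases a; cases b) (auto simp: f_arc pair_arc_def)
  qed
  have irr: "(p, p) \<notin> r" for p
    using no_loops by (fastforce simp: r)
  have asym: "(q, p) \<in> r \<longleftrightarrow> (p, q) \<notin> r" if "p \<in> pverts D" "q \<in> pverts D" "p \<noteq> q" for p q
    using tour[OF that] odds_sym[of p q] by (auto simp: r)
  have trans: "(p, s) \<in> r" if "p \<in> pverts D" "q \<in> pverts D" "s \<in> pverts D" "(p, q) \<in> r" "(q, s) \<in> r"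
    for p q s
  proof -
    have "p \<noteq> q" "q \<noteq> s"
      using that irr by auto
    moreover from this have "p \<noteq> s"
      using that asym by blast
    ultimately have "(s, p) \<notin> r"
      using that assms(3) acyclic_digraph_no_triangle[of "Inv D Xs" p q s]
      by (simp add: decycling_family_def r_def)
    then show ?thesis
      using asym[of p s] that \<open>p \<noteq> s\<close> by blast
  qed
  have "\<exists>h. bij_betw h (pverts D) {..<card (pverts D)} \<and>
      (\<forall>p\<in>pverts D. \<forall>q\<in>pverts D. h p < h q \<longleftrightarrow> (p, q) \<in> r)"
  proof (rule exists_ranking)
    show "(p, s) \<in> r" if "p \<in> pverts D" "q \<in> pverts D" "s \<in> pverts D" "(p, q) \<in> r" "(q, s) \<in> r"
      for p q s
      using that by (rule trans)
    show "(p, q) \<in> r \<or> (q, p) \<in> r" if "p \<in> pverts D" "q \<in> pverts D" "p \<noteq> q" for p q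
      using asym[OF that] by blast
  qed (simp_all add: irr)
  then obtain h where h: "bij_betw h (pverts D) {..<card (pverts D)}"
    and h_less: "\<forall>p\<in>pverts D. \<forall>q\<in>pverts D. h p < h q \<longleftrightarrow> (p, q) \<in> r"
    by (elim exE conjE)
  have card: "card (pverts D) = 2 * Suc n"
    unfolding V by (simp add: card_image[OF f_inj] card_cartesian_product)
  interpret chord_diagram "length Xs" "Suc n" "\<lambda>i a l. of_bool (f i a \<in> Xs ! l)" "\<lambda>i a. h (f i a)"
  proof
    fix i j a b
    assume ij: "i < Suc n" "j < Suc n"
    show "i = j \<and> a = b" if "h (f i a) = h (f j b)"
    proof -
      have "f i a = f j b"
        using that inj_onD[OF bij_betw_imp_inj_on[OF h]] mem ij by simp
      then show ?thesis
        using f_eq ij by simp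
    qed
    show "dot (length Xs) (\<lambda>l. of_bool (f i a \<in> Xs ! l)) (\<lambda>l. of_bool (f j b \<in> Xs ! l)) =
        of_bool (h (f i a) < h (f j b)) + of_bool (pair_arc i a j b)" if "i \<noteq> j \<or> a \<noteq> b"
    proof -
      have ne: "f i a \<noteq> f j b"
        using that f_eq ij by auto
      \<comment> \<open>The coordinatewise product marks the sets containing both vertices, so the
        sum over the two-element field is the parity of their number.\<close>
      have "dot (length Xs) (\<lambda>l. of_bool (f i a \<in> Xs ! l)) (\<lambda>l. of_bool (f j b \<in> Xs ! l)) =
          of_bool (odds (f i a) (f j b))"
        unfolding dot_def odds_def sum_of_bool_nth[symmetric] of_bool_conj ..
      moreover have "h (f i a) < h (f j b) \<longleftrightarrow> (odds (f i a) (f j b) \<longleftrightarrow> \<not> pair_arc i a j b)"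
        using ij mem ne tour[of "f i a" "f j b"] by (simp add: h_less r f_arc)
      ultimately show ?thesis
        by (cases "odds (f i a) (f j b)"; cases "pair_arc i a j b") simp_all
    qed
  next
    fix i a
    assume "i < Suc n"
    then show "h (f i a) < 2 * Suc n"
      using h mem[of i a] card unfolding bij_betw_def by auto
  next
    fix t
    assume "t < 2 * Suc n"
    then have "t \<in> h ` pverts D"
      using h card unfolding bij_betw_def by simp
    then show "\<exists>i<Suc n. \<exists>a. h (f i a) = t"
      unfolding V by (auto simp: less_Suc_eq_le)
  qed
  show ?thesis
    using dimension_bound by simp
qed

theorem theorem5p2:
  fixes T D :: "'a pair_pre_digraph" and k :: nat
  assumes "k > 0"
    and "is_TT2 T"
    and "(is_triangle ^^ (k - 1)) T D"
  shows "real (inversion_number D) \<ge> real k / 2 - 1"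
proof -
  have "{length Xs | Xs. decycling_family D Xs} \<noteq> {}"
    using exists_decycling_family[OF iterated_triangle_oriented[OF assms(2,3)]] by blast
  then have "inversion_number D \<in> {length Xs | Xs. decycling_family D Xs}"
    unfolding inversion_number_def by (rule Inf_nat_def1)
  \<comment> \<open>The attained minimum is the length of an actual decycling family; the resulting
    bound \<open>(k - 1) / 2\<close> exceeds the claimed one.\<close>
  then have "k - 1 \<le> 2 * inversion_number D"
    using decycling_family_length[OF assms(2,3)] by auto
  then show ?thesis
    using assms(1) by linarith
qed

end
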